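(* Let $G$ be a finite graph. Then $$\chi_{lid}(G\backslash\mathcal{R})-t(G)\;\leq\; \chi_{lid}(G)\;\leq\; \chi_{lid}(G\backslash\mathcal{R})+(T(G)-1)\cdot t(G).$$
   Context: Graphs are finite, simple and undirected. For a vertex $u$ of $G$, $N[u]$ denotes its closed neighborhood ($u$ together with its neighbors). Two distinct vertices $u,v$ are twins if $N[u]=N[v]$. For a map $c:V(G)\to\mathbb{N}$ and $X\subseteq V(G)$, $c(X)=\{c(x): x\in X\}$. A pair of vertices $u,v$ is identified by $c$ if $c(N[u])\neq c(N[v])$. A locally identifying coloring (lid-coloring) of $G$ is a map $c:V(G)\to\mathbb{N}$ which is proper (that is, $c(u)\neq c(v)$ for all adjacent $u,v$) and such that every pair of adjacent non-twin vertices is identified. $\chi_{lid}(G)$ is the smallest number of colors used by a lid-coloring of $G$. Let $\mathcal{R}$ be the equivalence relation on $V(G)$ given by $u\,\mathcal{R}\,v$ iff $N[u]=N[v]$. $G\backslash\mathcal{R}$ denotes the maximal twin-free subgraph of $G$, i.e. the quotient of $G$ by $\mathcal{R}$; equivalently (up to isomorphism) the subgraph of $G$ induced by a set containing exactly one vertex from each $\mathcal{R}$-class. $t(G)$ is the number of $\mathcal{R}$-classes of $G$ having at least two vertices, and $T(G)$ is the cardinality of a largest $\mathcal{R}$-class. *)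

theory Defs
  imports "Graph_Theory.Pair_Digraph"
begin

text \<open>
  Finite simple undirected graphs are the structures satisfying \<^locale>\<open>pair_graph\<close>:
  a finite vertex set \<^const>\<open>pverts\<close> with a symmetric irreflexive edge relation \<^const>\<open>parcs\<close>.
  The graph without vertices is allowed.
\<close>

definition closed_nbhd :: "'a pair_pre_digraph \<Rightarrow> 'a \<Rightarrow> 'a set" where
  "closed_nbhd G u = insert u {v. (u, v) \<in> parcs G}"

definition twins :: "'a pair_pre_digraph \<Rightarrow> 'a \<Rightarrow> 'a \<Rightarrow> bool" where
  "twins G u v \<longleftrightarrow> u \<noteq> v \<and> closed_nbhd G u = closed_nbhd G v"

definition identified :: "'a pair_pre_digraph \<Rightarrow> ('a \<Rightarrow> nat) \<Rightarrow> 'a \<Rightarrow> 'a \<Rightarrow> bool" where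
  "identified G c u v \<longleftrightarrow> c ` closed_nbhd G u \<noteq> c ` closed_nbhd G v"

definition proper_coloring :: "'a pair_pre_digraph \<Rightarrow> ('a \<Rightarrow> nat) \<Rightarrow> bool" where
  "proper_coloring G c \<longleftrightarrow> (\<forall>(u, v) \<in> parcs G. c u \<noteq> c v)"

definition lid_coloring :: "'a pair_pre_digraph \<Rightarrow> ('a \<Rightarrow> nat) \<Rightarrow> bool" where
  "lid_coloring G c \<longleftrightarrow>
     proper_coloring G c \<and> (\<forall>(u, v) \<in> parcs G. \<not> twins G u v \<longrightarrow> identified G c u v)"

text \<open>
  Colorings are total functions on the vertex type; only the values on \<^term>\<open>pverts G\<close> count.
\<close>

definition chi_lid :: "'a pair_pre_digraph \<Rightarrow> nat" where
  "chi_lid G = (LEAST k. \<exists>c. lid_coloring G c \<and> card (c ` pverts G) = k)"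

definition twin_rel :: "'a pair_pre_digraph \<Rightarrow> 'a rel" where
  "twin_rel G = {(u, v). u \<in> pverts G \<and> v \<in> pverts G \<and> closed_nbhd G u = closed_nbhd G v}"

definition twin_classes :: "'a pair_pre_digraph \<Rightarrow> 'a set set" where
  "twin_classes G = pverts G // twin_rel G"

definition twin_quotient :: "'a pair_pre_digraph \<Rightarrow> 'a set pair_pre_digraph" where
  "twin_quotient G =
     \<lparr> pverts = twin_classes G,
       parcs = {(X, Y). X \<in> twin_classes G \<and> Y \<in> twin_classes G \<and> X \<noteq> Y \<and>
                  (\<exists>u \<in> X. \<exists>v \<in> Y. (u, v) \<in> parcs G)} \<rparr>"

definition num_nontrivial_classes :: "'a pair_pre_digraph \<Rightarrow> nat" where
  "num_nontrivial_classes G = card {X \<in> twin_classes G. card X \<ge> 2}"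

text \<open>
  For the graph without vertices the following value is the unspecified \<^term>\<open>Max {} :: nat\<close>;
  it is then only ever multiplied by \<^term>\<open>num_nontrivial_classes G\<close>, which is \<open>0\<close>.
\<close>

definition max_class_size :: "'a pair_pre_digraph \<Rightarrow> nat" where
  "max_class_size G = Max (card ` twin_classes G)"


lemma equiv_twin_rel: "equiv (pverts G) (twin_rel G)"
  by (auto simp: equiv_def refl_on_def sym_def trans_def twin_rel_def)

lemma twin_classes_closed_nbhd:
  assumes "X \<in> twin_classes G" "u \<in> X" "v \<in> X"
  shows "closed_nbhd G u = closed_nbhd G v"
  using assms by (auto simp: twin_classes_def quotient_def twin_rel_def)

lemma (in pair_graph) twin_classes_arc:
  assumes "X \<in> twin_classes G" "Y \<in> twin_classes G" "X \<noteq> Y"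
    and "u \<in> X" "u' \<in> X" "v \<in> Y" "v' \<in> Y" "(u, v) \<in> parcs G"
  shows "(u', v') \<in> parcs G"
proof -
  have uu: "closed_nbhd G u = closed_nbhd G u'"
    using assms(1,4,5) by (rule twin_classes_closed_nbhd)
  have vv: "closed_nbhd G v = closed_nbhd G v'"
    using assms(2,6,7) by (rule twin_classes_closed_nbhd)
  have "X \<inter> Y = {}"
    using assms(1-3) quotient_disj[OF equiv_twin_rel, of X G Y] by (simp add: twin_classes_def)
  then have ne: "u' \<noteq> v" "v' \<noteq> u'" using assms(5-7) by auto
  have "v \<in> closed_nbhd G u'" using assms(8) unfolding uu[symmetric] by (simp add: closed_nbhd_def)
  then have "(u', v) \<in> parcs G" using ne(1) by (simp add: closed_nbhd_def)
  then have "(v, u') \<in> parcs G" by (rule arcs_symmetric)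
  then have "u' \<in> closed_nbhd G v'" unfolding vv[symmetric] by (simp add: closed_nbhd_def)
  then have "(v', u') \<in> parcs G" using ne(2) by (simp add: closed_nbhd_def)
  then show ?thesis by (rule arcs_symmetric)
qed

lemma (in pair_graph) pair_graph_twin_quotient: "pair_graph (twin_quotient G)"
proof -
  have fin: "finite (twin_classes G)"
    unfolding twin_classes_def
    by (rule finite_quotient[OF pair_finite_verts]) (auto simp: twin_rel_def)
  show ?thesis
  proof
    show "finite (parcs (twin_quotient G))"
      by (rule finite_subset[of _ "twin_classes G \<times> twin_classes G"])
        (auto simp: twin_quotient_def fin)
    show "symmetric (twin_quotient G)"
      unfolding symmetric_def with_proj_simps twin_quotient_def sym_def
      by (simp, blast intro: arcs_symmetric)
  qed (auto simp: twin_quotient_def fin)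
qed

text \<open>
  The quotient is, up to isomorphism, the subgraph induced by any set \<open>S\<close> that contains exactly
  one vertex from each class.
\<close>

lemma (in pair_graph) twin_quotient_iso_induced:
  assumes "S \<subseteq> pverts G" and "\<And>X. X \<in> twin_classes G \<Longrightarrow> \<exists>!u. u \<in> S \<inter> X"
  defines "f \<equiv> \<lambda>u. twin_rel G `` {u}"
  shows "bij_betw f S (pverts (twin_quotient G))"
    and "\<And>u v. u \<in> S \<Longrightarrow> v \<in> S \<Longrightarrow> (f u, f v) \<in> parcs (twin_quotient G) \<longleftrightarrow> (u, v) \<in> parcs G"
proof -
  have cls: "f u \<in> twin_classes G" "u \<in> f u" if "u \<in> S" for u
    using that assms(1) quotientI[of u "pverts G" "twin_rel G"]
    by (auto simp: f_def twin_classes_def) (auto simp: twin_rel_def)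
  have inj: "inj_on f S"
    using cls assms(2) by (intro inj_onI) (metis IntI)
  have surj: "X \<in> f ` S" if "X \<in> twin_classes G" for X
  proof -
    from assms(2)[OF that] obtain u where u: "u \<in> S" "u \<in> X" by blast
    then have "X = f u"
      using that cls[OF u(1)] quotient_disj[OF equiv_twin_rel, of X G "f u"]
      unfolding twin_classes_def by blast
    with u show ?thesis by blast
  qed
  show "bij_betw f S (pverts (twin_quotient G))"
    using inj surj cls(1) by (auto simp: bij_betw_def twin_quotient_def)
  fix u v assume uv: "u \<in> S" "v \<in> S"
  show "(f u, f v) \<in> parcs (twin_quotient G) \<longleftrightarrow> (u, v) \<in> parcs G"
  proof
    assume "(f u, f v) \<in> parcs (twin_quotient G)"
    then obtain a b where "a \<in> f u" "b \<in> f v" "(a, b) \<in> parcs G" "f u \<noteq> f v"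
      by (auto simp: twin_quotient_def)
    then show "(u, v) \<in> parcs G"
      using twin_classes_arc[OF cls(1)[OF uv(1)] cls(1)[OF uv(2)]] cls(2) uv by blast
  next
    assume a: "(u, v) \<in> parcs G"
    then have "f u \<noteq> f v" using inj uv no_loops' by (auto dest: inj_onD)
    with a show "(f u, f v) \<in> parcs (twin_quotient G)"
      using cls(1)[OF uv(1)] cls(1)[OF uv(2)] cls(2)[OF uv(1)] cls(2)[OF uv(2)]
      unfolding twin_quotient_def by auto
  qed
qed

end

theory Submission
  imports Defs
begin

text \<open>
  Write \<open>H\<close> for the quotient; it is twin-free.  For the upper bound, colour one representative of
  each class as in \<open>H\<close> and give every other vertex a fresh private colour: the old colours alone
  already identify adjacent non-twins.  For the lower bound, keep the colours of the trivial
  classes and give every nontrivial class a fresh private colour.  If two closed neighbourhoods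
  of \<open>H\<close> contain the same nontrivial classes, then any colour that distinguished them in \<open>G\<close>
  occurs on a trivial class, and so it still distinguishes them.
\<close>

abbreviation twin_class :: "'a pair_pre_digraph \<Rightarrow> 'a \<Rightarrow> 'a set" where
  "twin_class G u \<equiv> twin_rel G `` {u}"

section \<open>Extremal colourings and elementary facts on closed neighbourhoods\<close>

lemma chi_lid_le: "lid_coloring G c \<Longrightarrow> chi_lid G \<le> card (c ` pverts G)"
  unfolding chi_lid_def by (rule Least_le) blast

text \<open>Supplies the offset \<open>m\<close> above all colours in use, so that colours of the
  form \<open>m + e x\<close> are fresh.\<close>

lemma finite_nat_image_bound:
  fixes f :: "'a \<Rightarrow> nat"
  assumes "finite A"
  obtains m where "\<And>x. x \<in> A \<Longrightarrow> f x < m"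
  using finite_nat_set_iff_bounded[of "f ` A"] assms by auto

context pair_graph
begin

lemma closed_nbhd_subset_verts: "u \<in> pverts G \<Longrightarrow> closed_nbhd G u \<subseteq> pverts G"
  by (auto simp: closed_nbhd_def dest: in_arcsD2)

lemma closed_nbhd_sym: "u \<in> closed_nbhd G v \<longleftrightarrow> v \<in> closed_nbhd G u"
  by (auto simp: closed_nbhd_def intro: arcs_symmetric)

text \<open>A colouring that is injective on the vertices is a lid-coloring, since it maps distinct
  closed neighbourhoods to distinct sets. So \<open>LEAST\<close> ranges over a nonempty set and its
  value is attained.\<close>

lemma chi_lid_attained:
  obtains c where "lid_coloring G c" "card (c ` pverts G) = chi_lid G"
proof -
  obtain e :: "'a \<Rightarrow> nat" where e: "inj_on e (pverts G)"
    using finite_imp_inj_to_nat_seg[OF pair_finite_verts] by blast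
  have "lid_coloring G e"
    unfolding lid_coloring_def proper_coloring_def
  proof (intro conjI ballI; clarify)
    fix u v assume uv: "(u, v) \<in> parcs G"
    then have V: "u \<in> pverts G" "v \<in> pverts G" by (auto dest: in_arcsD1 in_arcsD2)
    have "u \<noteq> v" using uv no_loops' by blast
    then show "e u = e v \<Longrightarrow> False" using e V by (auto dest: inj_onD)
    assume "\<not> twins G u v"
    then show "identified G e u v"
      using \<open>u \<noteq> v\<close> inj_on_image_eq_iff[OF e] closed_nbhd_subset_verts V
      by (auto simp: twins_def identified_def)
  qed
  then have "\<exists>k c. lid_coloring G c \<and> card (c ` pverts G) = k" by blast
  from LeastI_ex[OF this] show ?thesis
    unfolding chi_lid_def[symmetric] using that by blast
qed

section \<open>Twin classes and closed neighbourhoods in the quotient\<close>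

lemma finite_twin_classes: "finite (twin_classes G)"
  unfolding twin_classes_def
  by (rule finite_quotient[OF pair_finite_verts]) (auto simp: twin_rel_def)

lemma finite_twin_class: "X \<in> twin_classes G \<Longrightarrow> finite X"
  using pair_finite_verts
  by (auto simp: twin_classes_def quotient_def twin_rel_def intro: finite_subset)

lemma twin_class_in_twin_classes: "u \<in> pverts G \<Longrightarrow> twin_class G u \<in> twin_classes G"
  by (auto simp: twin_classes_def intro: quotientI)

lemma twin_classes_eq_image: "twin_classes G = twin_class G ` pverts G"
  by (auto simp: twin_classes_def quotient_def)

lemma self_in_twin_class: "u \<in> pverts G \<Longrightarrow> u \<in> twin_class G u"
  by (auto simp: twin_rel_def)

lemma twin_class_eq_iff:
  assumes "u \<in> pverts G" "v \<in> pverts G"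
  shows "twin_class G u = twin_class G v \<longleftrightarrow> closed_nbhd G u = closed_nbhd G v"
  using eq_equiv_class_iff[OF equiv_twin_rel assms] assms by (auto simp: twin_rel_def)

lemma twin_class_of_member:
  assumes "X \<in> twin_classes G" "u \<in> X"
  shows "u \<in> pverts G" "twin_class G u = X"
  using assms unfolding twin_classes_def quotient_def by (auto simp: twin_rel_def)

text \<open>For distinct classes, adjacency does not depend on the representatives by
  \<open>twin_classes_arc\<close>. For equal classes both sides hold, because \<open>v\<close> lies
  in its own closed neighbourhood, which is that of \<open>u\<close>.\<close>

lemma closed_nbhd_twin_class:
  assumes "u \<in> pverts G" "v \<in> pverts G"
  shows "twin_class G v \<in> closed_nbhd (twin_quotient G) (twin_class G u)
    \<longleftrightarrow> v \<in> closed_nbhd G u"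
proof (cases "twin_class G v = twin_class G u")
  case True
  then have "closed_nbhd G v = closed_nbhd G u" using twin_class_eq_iff assms by blast
  with True show ?thesis by (auto simp: closed_nbhd_def)
next
  case False
  then have "u \<noteq> v" by blast
  note C = twin_class_in_twin_classes[OF assms(1)] twin_class_in_twin_classes[OF assms(2)]
  note S = self_in_twin_class[OF assms(1)] self_in_twin_class[OF assms(2)]
  have "(twin_class G u, twin_class G v) \<in> parcs (twin_quotient G) \<longleftrightarrow> (u, v) \<in> parcs G"
    using C S False twin_classes_arc[OF C, OF False[symmetric] _ S(1) _ S(2)]
    unfolding twin_quotient_def by auto
  with False \<open>u \<noteq> v\<close> show ?thesis by (auto simp: closed_nbhd_def)
qed

lemma closed_nbhd_twin_quotient:
  assumes "u \<in> pverts G"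
  shows "closed_nbhd (twin_quotient G) (twin_class G u) = twin_class G ` closed_nbhd G u"
proof -
  have "closed_nbhd (twin_quotient G) (twin_class G u) \<subseteq> twin_class G ` pverts G"
    using twin_class_in_twin_classes[OF assms]
    by (auto simp: closed_nbhd_def twin_quotient_def twin_classes_eq_image)
  then show ?thesis
    using closed_nbhd_twin_class[OF assms] closed_nbhd_subset_verts[OF assms] by blast
qed

text \<open>The closed neighbourhood of a class determines that of its vertices, by
  \<open>closed_nbhd_twin_class\<close>, and hence determines the class.\<close>

lemma twin_quotient_no_twins:
  assumes "X \<in> twin_classes G" "Y \<in> twin_classes G"
  shows "\<not> twins (twin_quotient G) X Y"
proof -
  obtain u v where uv: "u \<in> pverts G" "v \<in> pverts G" "X = twin_class G u" "Y = twin_class G v"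
    using assms by (auto simp: twin_classes_eq_image)
  have "closed_nbhd G u = closed_nbhd G v"
    if "closed_nbhd (twin_quotient G) X = closed_nbhd (twin_quotient G) Y"
    using that closed_nbhd_twin_class uv closed_nbhd_subset_verts by blast
  then show ?thesis using twin_class_eq_iff uv by (auto simp: twins_def)
qed

section \<open>Lower bound: from a colouring of the graph to one of the quotient\<close>

lemma chi_lid_twin_quotient_le:
  "chi_lid (twin_quotient G) \<le> chi_lid G + num_nontrivial_classes G"
proof -
  let ?H = "twin_quotient G" and ?N = "{X \<in> twin_classes G. card X \<ge> 2}"
  obtain c where c: "lid_coloring G c" "card (c ` pverts G) = chi_lid G"
    by (rule chi_lid_attained)
  obtain m where m: "\<And>v. v \<in> pverts G \<Longrightarrow> c v < m"
    using finite_nat_image_bound[OF pair_finite_verts] by blast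
  obtain e :: "'a set \<Rightarrow> nat" where e: "inj_on e (twin_classes G)"
    using finite_imp_inj_to_nat_seg[OF finite_twin_classes] by blast
  \<comment> \<open>Nontrivial classes get pairwise distinct colours from \<open>m\<close> upwards,
    outside the range of \<open>c\<close> on the vertices. Every other class is a singleton, so
    there \<open>the_elem X\<close> is its only vertex.\<close>
  define d where "d X = (if card X \<ge> 2 then m + e X else c (the_elem X))" for X
  have single: "twin_class G u = {u}" if "u \<in> pverts G" "\<not> card (twin_class G u) \<ge> 2" for u
  proof -
    have "card (twin_class G u) \<noteq> 0"
      using self_in_twin_class[OF that(1)]
        finite_twin_class[OF twin_class_in_twin_classes[OF that(1)]] by (metis card_0_eq empty_iff)
    then have "card (twin_class G u) = 1" using that(2) by linarith
    then obtain x where "twin_class G u = {x}" by (rule card_1_singletonE)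
    with self_in_twin_class[OF that(1)] show ?thesis by (simp only: singleton_iff)
  qed
  have d_big: "d (twin_class G u) = m + e (twin_class G u)" if "card (twin_class G u) \<ge> 2" for u
    using that by (simp add: d_def)
  have d_small: "d (twin_class G u) = c u"
    if "u \<in> pverts G" "\<not> card (twin_class G u) \<ge> 2" for u
    using that single[OF that] by (simp add: d_def)
  \<comment> \<open>A fresh colour determines its class and never equals an old one, so distinct
    classes can share a colour only if both are trivial.\<close>
  have d_eq: "twin_class G u = twin_class G v \<or> (\<not> card (twin_class G u) \<ge> 2 \<and>
      \<not> card (twin_class G v) \<ge> 2 \<and> c u = c v)"
    if "u \<in> pverts G" "v \<in> pverts G" "d (twin_class G u) = d (twin_class G v)" for u v
    using that(3) d_big[of u] d_big[of v] d_small[OF that(1)] d_small[OF that(2)]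
      m[OF that(1)] m[OF that(2)]
      inj_onD[OF e _ twin_class_in_twin_classes[OF that(1)] twin_class_in_twin_classes[OF that(2)]]
    by (cases "card (twin_class G u) \<ge> 2"; cases "card (twin_class G v) \<ge> 2") simp_all
  \<comment> \<open>Identification is transferred in contrapositive form: if \<open>d\<close> fails
    to separate two classes, then \<open>c\<close> fails to separate their vertices.\<close>
  have colours_subset: "c ` closed_nbhd G u \<subseteq> c ` closed_nbhd G v"
    if u: "u \<in> pverts G" and v: "v \<in> pverts G"
      and eq: "d ` closed_nbhd ?H (twin_class G u) = d ` closed_nbhd ?H (twin_class G v)" for u v
  proof clarify
    fix w assume w: "w \<in> closed_nbhd G u"
    then have wV: "w \<in> pverts G" using closed_nbhd_subset_verts[OF u] by blast
    have "d (twin_class G w) \<in> d ` twin_class G ` closed_nbhd G v"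
      using w eq unfolding closed_nbhd_twin_quotient[OF u] closed_nbhd_twin_quotient[OF v] by blast
    then obtain w' where w': "w' \<in> closed_nbhd G v" "d (twin_class G w) = d (twin_class G w')"
      by (elim imageE) simp
    then have w'V: "w' \<in> pverts G" using closed_nbhd_subset_verts[OF v] by blast
    from d_eq[OF wV w'V w'(2)] show "c w \<in> c ` closed_nbhd G v"
    proof
      assume "twin_class G w = twin_class G w'"
      \<comment> \<open>Here \<open>c w\<close> and \<open>c w'\<close> may differ. Instead
        \<open>w\<close> itself is in the closed neighbourhood of \<open>v\<close>, as it has the
        same closed neighbourhood as \<open>w'\<close>.\<close>
      then have "closed_nbhd G w = closed_nbhd G w'" using twin_class_eq_iff wV w'V by blast
      then have "w \<in> closed_nbhd G v" using w'(1) closed_nbhd_sym by blast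
      then show ?thesis by blast
    next
      assume "\<not> card (twin_class G w) \<ge> 2 \<and> \<not> card (twin_class G w') \<ge> 2 \<and> c w = c w'"
      then show ?thesis using w'(1) by simp
    qed
  qed
  have "lid_coloring ?H d"
    unfolding lid_coloring_def proper_coloring_def
  proof (intro conjI ballI; clarify)
    fix X Y assume XY: "(X, Y) \<in> parcs ?H"
    then obtain u v where uv: "(u, v) \<in> parcs G" "u \<in> X" "v \<in> Y" and ne: "X \<noteq> Y"
      and C: "X \<in> twin_classes G" "Y \<in> twin_classes G"
      by (auto simp: twin_quotient_def)
    note U = twin_class_of_member[OF C(1) uv(2)] and V = twin_class_of_member[OF C(2) uv(3)]
    show "d X = d Y \<Longrightarrow> False"
      using d_eq[OF U(1) V(1)] ne uv(1) c(1) unfolding U(2) V(2)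
      by (auto simp: lid_coloring_def proper_coloring_def)
    have "\<not> twins G u v" using ne twin_class_eq_iff U V by (auto simp: twins_def)
    then have "c ` closed_nbhd G u \<noteq> c ` closed_nbhd G v"
      using c(1) uv(1) by (auto simp: lid_coloring_def identified_def)
    then show "identified ?H d X Y"
      using colours_subset[OF U(1) V(1)] colours_subset[OF V(1) U(1)]
      unfolding identified_def U(2) V(2) by (metis subset_antisym)
  qed
  then have "chi_lid ?H \<le> card (d ` twin_classes G)"
    using chi_lid_le[of ?H d] by (simp add: twin_quotient_def)
  \<comment> \<open>Trivial classes reuse colours of \<open>c\<close>, and each nontrivial class
    adds at most one new colour.\<close>
  also have "\<dots> \<le> card (c ` pverts G \<union> d ` ?N)"
  proof (rule card_mono)
    show "d ` twin_classes G \<subseteq> c ` pverts G \<union> d ` ?N"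
      using d_small by (auto simp: twin_classes_eq_image)
  qed (use pair_finite_verts finite_twin_classes in auto)
  also have "\<dots> \<le> card (c ` pverts G) + card ?N"
    using card_Un_le[of "c ` pverts G" "d ` ?N"] card_image_le[of ?N d] finite_twin_classes
    by fastforce
  finally show ?thesis using c(2) by (simp add: num_nontrivial_classes_def)
qed

section \<open>Upper bound: from a colouring of the quotient to one of the graph\<close>

lemma chi_lid_le_twin_quotient:
  "chi_lid G \<le> chi_lid (twin_quotient G) + (max_class_size G - 1) * num_nontrivial_classes G"
proof -
  let ?H = "twin_quotient G" and ?N = "{X \<in> twin_classes G. card X \<ge> 2}"
  interpret H: pair_graph ?H by (rule pair_graph_twin_quotient)
  have vertsH: "pverts ?H = twin_classes G" by (simp add: twin_quotient_def)
  obtain c where c: "lid_coloring ?H c" "card (c ` twin_classes G) = chi_lid ?H"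
    using H.chi_lid_attained unfolding vertsH by blast
  obtain m where m: "\<And>X. X \<in> twin_classes G \<Longrightarrow> c X < m"
    using finite_nat_image_bound[OF finite_twin_classes] by blast
  obtain e :: "'a \<Rightarrow> nat" where e: "inj_on e (pverts G)"
    using finite_imp_inj_to_nat_seg[OF pair_finite_verts] by blast
  define r :: "'a set \<Rightarrow> 'a" where "r X = (SOME u. u \<in> X)" for X
  have r: "r X \<in> X" if "X \<in> twin_classes G" for X
    unfolding r_def
    by (rule someI_ex) (use that self_in_twin_class twin_classes_eq_image in blast)
  define d where
    "d v = (if v = r (twin_class G v) then c (twin_class G v) else m + e v)" for v
  let ?R = "{v \<in> pverts G. v \<noteq> r (twin_class G v)}"
  have d_eq: "u = v \<or> c (twin_class G u) = c (twin_class G v)"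
    if "u \<in> pverts G" "v \<in> pverts G" "d u = d v" for u v
    using that m[OF twin_class_in_twin_classes[OF that(1)]]
      m[OF twin_class_in_twin_classes[OF that(2)]] inj_onD[OF e _ that(1,2)]
    by (auto simp: d_def split: if_splits)
  \<comment> \<open>The colours below \<open>m\<close> around \<open>u\<close> recover the colour
    set around its class in the quotient: the representative of every class in that closed
    neighbourhood lies in the closed neighbourhood of \<open>u\<close>, and all other vertices have
    colours at least \<open>m\<close>.\<close>
  have old_colours: "d ` closed_nbhd G u \<inter> {..<m} = c ` closed_nbhd ?H (twin_class G u)"
    if u: "u \<in> pverts G" for u
  proof (intro subset_antisym subsetI)
    fix a assume "a \<in> d ` closed_nbhd G u \<inter> {..<m}"
    then show "a \<in> c ` closed_nbhd ?H (twin_class G u)"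
      by (auto simp: closed_nbhd_twin_quotient[OF u] d_def split: if_splits)
  next
    fix a assume "a \<in> c ` closed_nbhd ?H (twin_class G u)"
    then obtain X where X: "a = c X" "X \<in> closed_nbhd ?H (twin_class G u)" by blast
    have XC: "X \<in> twin_classes G"
      using X(2) H.closed_nbhd_subset_verts twin_class_in_twin_classes[OF u]
      unfolding vertsH by blast
    note R = twin_class_of_member[OF XC r[OF XC]]
    have "r X \<in> closed_nbhd G u" using X(2) closed_nbhd_twin_class[OF u R(1)] R(2) by simp
    moreover have "a = d (r X)" using R(2) X(1) by (simp add: d_def)
    ultimately have "a \<in> d ` closed_nbhd G u" by (rule rev_image_eqI)
    then show "a \<in> d ` closed_nbhd G u \<inter> {..<m}" using m[OF XC] X(1) by simp
  qed
  have "lid_coloring G d"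
    unfolding lid_coloring_def proper_coloring_def
  proof (intro conjI ballI; clarify)
    fix u v assume uv: "(u, v) \<in> parcs G"
    then have V: "u \<in> pverts G" "v \<in> pverts G" by (auto dest: in_arcsD1 in_arcsD2)
    have "u \<noteq> v" using uv no_loops' by blast
    have arcH: "(twin_class G u, twin_class G v) \<in> parcs ?H"
      if "twin_class G u \<noteq> twin_class G v"
      using that uv V twin_class_in_twin_classes self_in_twin_class
      unfolding twin_quotient_def by fastforce
    show False if "d u = d v"
    proof (cases "twin_class G u = twin_class G v")
      case True
      \<comment> \<open>Of two distinct vertices in one class at most one is the representative; the
        other has a private colour.\<close>
      then show False
        using that \<open>u \<noteq> v\<close> inj_onD[OF e _ V]
          m[OF twin_class_in_twin_classes[OF V(1)]] m[OF twin_class_in_twin_classes[OF V(2)]]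
        by (auto simp: d_def split: if_splits)
    next
      case False
      then show False
        using d_eq[OF V that] \<open>u \<noteq> v\<close> arcH c(1)
        by (auto simp: lid_coloring_def proper_coloring_def)
    qed
    assume "\<not> twins G u v"
    then have "twin_class G u \<noteq> twin_class G v"
      using \<open>u \<noteq> v\<close> twin_class_eq_iff V by (auto simp: twins_def)
    \<comment> \<open>As the quotient has no twins, \<open>c\<close> identifies every pair of
      adjacent classes.\<close>
    then have "c ` closed_nbhd ?H (twin_class G u) \<noteq> c ` closed_nbhd ?H (twin_class G v)"
      using arcH c(1) twin_quotient_no_twins V twin_class_in_twin_classes
      by (fastforce simp: lid_coloring_def identified_def)
    then show "identified G d u v"
      using old_colours[OF V(1)] old_colours[OF V(2)] unfolding identified_def by metis
  qed
  then have "chi_lid G \<le> card (d ` pverts G)" by (rule chi_lid_le)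
  also have "\<dots> \<le> card (c ` twin_classes G \<union> d ` ?R)"
  proof (rule card_mono)
    show "d ` pverts G \<subseteq> c ` twin_classes G \<union> d ` ?R"
      using twin_class_in_twin_classes by (auto simp: d_def)
  qed (use pair_finite_verts finite_twin_classes in auto)
  also have "\<dots> \<le> card (c ` twin_classes G) + card ?R"
    using card_Un_le[of "c ` twin_classes G" "d ` ?R"] card_image_le[of ?R d] pair_finite_verts
    by fastforce
  \<comment> \<open>The privately coloured vertices are counted class by class: each nontrivial
    class contributes all its members but the representative.\<close>
  also have "card ?R \<le> card (\<Union>X\<in>?N. X - {r X})"
  proof (rule card_mono)
    show "?R \<subseteq> (\<Union>X\<in>?N. X - {r X})"
    proof
      fix v assume v: "v \<in> ?R"
      let ?X = "twin_class G v"
      have C: "?X \<in> twin_classes G" using v twin_class_in_twin_classes by blast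
      \<comment> \<open>A vertex other than its representative witnesses that its class has at least
        two members.\<close>
      have "{v, r ?X} \<subseteq> ?X" using v r[OF C] self_in_twin_class by blast
      then have "card {v, r ?X} \<le> card ?X" using finite_twin_class[OF C] by (rule card_mono[rotated])
      then show "v \<in> (\<Union>X\<in>?N. X - {r X})" using v C self_in_twin_class by auto
    qed
  qed (use finite_twin_classes finite_twin_class in auto)
  also have "\<dots> \<le> (\<Sum>X\<in>?N. card (X - {r X}))"
    by (rule card_UN_le) (use finite_twin_classes in auto)
  also have "\<dots> \<le> (\<Sum>X\<in>?N. max_class_size G - 1)"
  proof (rule sum_mono)
    fix X assume X: "X \<in> ?N"
    then have "card X \<le> max_class_size G"
      unfolding max_class_size_def using finite_twin_classes by (intro Max_ge) auto
    then show "card (X - {r X}) \<le> max_class_size G - 1"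
      using X r by (simp add: card_Diff_singleton)
  qed
  finally show ?thesis using c(2) by (simp add: num_nontrivial_classes_def mult.commute)
qed

section \<open>From natural numbers to integers\<close>

lemma max_class_size_pos:
  assumes "num_nontrivial_classes G > 0"
  shows "max_class_size G \<ge> 1"
proof -
  obtain X where "X \<in> twin_classes G" "card X \<ge> 2"
    using assms by (auto simp: num_nontrivial_classes_def card_gt_0_iff)
  moreover from this(1) have "card X \<le> max_class_size G"
    unfolding max_class_size_def using finite_twin_classes by (intro Max_ge) auto
  ultimately show ?thesis by linarith
qed

end

theorem theorem1p3:
  fixes G :: "'a pair_pre_digraph"
  assumes "pair_graph G"
  shows "int (chi_lid (twin_quotient G)) - int (num_nontrivial_classes G) \<le> int (chi_lid G)
    \<and> int (chi_lid G) \<le>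
        int (chi_lid (twin_quotient G))
        + (int (max_class_size G) - 1) * int (num_nontrivial_classes G)"
proof -
  interpret pair_graph G by fact
  \<comment> \<open>Truncated subtraction is exact once some class is nontrivial. Otherwise both
    products vanish, whatever \<open>max_class_size G\<close> is; this covers the graph without
    vertices.\<close>
  have "int (max_class_size G - 1) * int (num_nontrivial_classes G)
      = (int (max_class_size G) - 1) * int (num_nontrivial_classes G)"
    using max_class_size_pos by (cases "num_nontrivial_classes G = 0") auto
  moreover have "int (chi_lid G) \<le> int (chi_lid (twin_quotient G))
      + int (max_class_size G - 1) * int (num_nontrivial_classes G)"
    using chi_lid_le_twin_quotient by (metis of_nat_add of_nat_mono of_nat_mult)
  ultimately show ?thesis using chi_lid_twin_quotient_le by linarith
qed

end
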